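(* If $\mathcal{P}\in\mathbb{R}^{n\times n\times n}$ is any transition tensor and $\mathcal{A}=\mathcal{I}-\mathcal{P}$, then the group inverse $\mathcal{A}^{\#}$ (under the C-product) exists.
   Context: For a third-order tensor $\mathcal{A}\in\mathbb{C}^{n\times n\times n}$, $\mathcal{A}^{(i)}=\mathcal{A}(:,:,i)\in\mathbb{C}^{n\times n}$ denotes its $i$-th frontal slice. Let $\mathbf{C}_{n}$ be the $n\times n$ orthogonal DCT matrix, with entries $(\mathbf{C}_{n})_{jk}=\sqrt{(2-\delta_{j1})/n}\,\cos\big(\tfrac{(j-1)(2k-1)\pi}{2n}\big)$; let $\mathbf{W}$ be the diagonal matrix whose diagonal is the first column of $\mathbf{C}_{n}$; let $\mathbf{Z}$ be the $n\times n$ matrix with ones on the first superdiagonal and zeros elsewhere; and put $\mathbf{M}=\mathbf{W}^{-1}\mathbf{C}_{n}(\mathbf{I}+\mathbf{Z})$, an invertible matrix. Define the linear bijection $L$ on tensors with third dimension $n$ by $L(\mathcal{A})_{ijk}=\sum_{l=1}^{n}\mathbf{M}_{kl}\mathcal{A}_{ijl}$. The C-product of $\mathcal{A},\mathcal{B}\in\mathbb{C}^{n\times n\times n}$ is the tensor $\mathcal{A}*_c\mathcal{B}$ determined by $L(\mathcal{A}*_c\mathcal{B})^{(i)}=L(\mathcal{A})^{(i)}L(\mathcal{B})^{(i)}$, $i=1,\dots,n$. The identity tensor $\mathcal{I}$ is determined by $L(\mathcal{I})^{(i)}=\mathbf{I}_n$ for all $i$. A transition tensor is a tensor $\mathcal{P}\in\mathbb{R}^{n\times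 n\times n}$ with $0\le\mathcal{P}_{i_1i_2i_3}\le 1$ for all $i_1,i_2,i_3$ (these being the transition probabilities $\mathrm{Prob}(X_t=i_1\mid X_{t-1}=i_2,X_{t-2}=i_3)$ of a higher-order Markov chain with values in $\{1,\dots,n\}$) and $\sum_{j=1}^n L(\mathcal{P})^{(i)}_{jk}=1$ for all $i=1,\dots,n$ and $1\le k\le n$. $\mathrm{mat}(\mathcal{A})$ is the $n\times n$ block Toeplitz-plus-Hankel matrix whose $(p,q)$ block is $\mathcal{A}^{(|p-q|+1)}+\mathbf{H}_{pq}$, where $\mathbf{H}_{pq}=\mathcal{A}^{(p+q)}$ if $p+q\le n$, $\mathbf{H}_{pq}=O$ if $p+q=n+1$, and $\mathbf{H}_{pq}=\mathcal{A}^{(2n+2-p-q)}$ if $p+q\ge n+2$. The index $\mathrm{Ind}(A)$ of a square matrix $A$ is the smallest nonnegative integer $k$ with $\mathrm{rank}(A^k)=\mathrm{rank}(A^{k+1})$, and $\mathrm{Ind}(\mathcal{A})=\mathrm{Ind}(\mathrm{mat}(\mathcal{A}))$. If $\mathrm{Ind}(\mathcal{A})=k$, the Drazin inverse of $\mathcal{A}$ is the tensor $\mathcal{X}$ with $\mathcal{A}^{k+1}*_c\mathcal{X}=\mathcal{A}^k$, $\mathcal{X}*_c\mathcal{A}*_c\mathcal{X}=\mathcal{X}$, $\mathcal{A}*_c\mathcal{X}=\mathcal{X}*_c\mathcal{A}$ (powers with respect to $*_c$). When $k=1$, $\mathcal{X}$ is called the group inverse of $\mathcal{A}$ and denoted $\mathcal{A}^\#$.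 *)

theory Defs
  imports
    Complex_Main
    "Jordan_Normal_Form.Matrix"
    "Jordan_Normal_Form.Gauss_Jordan_Elimination"
    "Jordan_Normal_Form.DL_Rank"
begin

text \<open>
  A third-order tensor is the list of its frontal slices.  All indices (of slices, of matrix
  entries and of blocks) start at 0, so the mathematical indices 1, ..., n become 0, ..., n - 1
  and index expressions in formulas are shifted accordingly.
\<close>

type_synonym 'a tensor = "'a mat list"

definition carrier_tensor :: "nat \<Rightarrow> 'a tensor set" where
  "carrier_tensor n = {A. length A = n \<and> set A \<subseteq> carrier_mat n n}"

definition tensor_minus :: "'a::minus tensor \<Rightarrow> 'a tensor \<Rightarrow> 'a tensor" where
  "tensor_minus A B = map2 (-) A B"

definition complex_tensor :: "real tensor \<Rightarrow> complex tensor" where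
  "complex_tensor A = map (map_mat complex_of_real) A"

definition dct_matrix :: "nat \<Rightarrow> complex mat" where
  "dct_matrix n = Matrix.mat n n (\<lambda>(j, k). complex_of_real
     (sqrt ((2 - (if j = 0 then 1 else 0)) / real n)
        * cos (real j * (2 * real k + 1) * pi / (2 * real n))))"

definition W_matrix :: "nat \<Rightarrow> complex mat" where
  "W_matrix n = mat_diag n (\<lambda>j. dct_matrix n $$ (j, 0))"

definition Z_matrix :: "nat \<Rightarrow> complex mat" where
  "Z_matrix n = Matrix.mat n n (\<lambda>(i, j). if j = i + 1 then 1 else 0)"

text \<open>
  \<open>W_matrix n\<close> is invertible for \<open>n > 0\<close>, its diagonal entries being positive multiples of
  \<open>cos (j * pi / (2 * n))\<close> with \<open>j < n\<close>.
\<close>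

definition M_matrix :: "nat \<Rightarrow> complex mat" where
  "M_matrix n = the (mat_inverse (W_matrix n)) * dct_matrix n * (1\<^sub>m n + Z_matrix n)"

definition L_transform :: "nat \<Rightarrow> complex tensor \<Rightarrow> complex tensor" where
  "L_transform n A = map (\<lambda>k. Matrix.mat n n (\<lambda>(i, j).
     \<Sum>l<n. M_matrix n $$ (k, l) * (A ! l) $$ (i, j))) [0..<n]"

text \<open>
  The descriptions below are well defined because \<open>M_matrix n\<close> is invertible for \<open>n > 0\<close>, which
  makes \<open>L_transform n\<close> a bijection of \<open>carrier_tensor n\<close>.
\<close>

definition cprod :: "nat \<Rightarrow> complex tensor \<Rightarrow> complex tensor \<Rightarrow> complex tensor" where
  "cprod n A B = (THE C. C \<in> carrier_tensor n \<and>
     (\<forall>i<n. L_transform n C ! i = L_transform n A ! i * L_transform n B ! i))"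

definition identity_tensor :: "nat \<Rightarrow> complex tensor" where
  "identity_tensor n = (THE C. C \<in> carrier_tensor n \<and> (\<forall>i<n. L_transform n C ! i = 1\<^sub>m n))"

primrec cpower :: "nat \<Rightarrow> complex tensor \<Rightarrow> nat \<Rightarrow> complex tensor" where
  "cpower n A 0 = identity_tensor n"
| "cpower n A (Suc k) = cprod n A (cpower n A k)"

definition transition_tensor :: "nat \<Rightarrow> real tensor \<Rightarrow> bool" where
  "transition_tensor n P \<longleftrightarrow> P \<in> carrier_tensor n \<and>
     (\<forall>i1<n. \<forall>i2<n. \<forall>i3<n. 0 \<le> (P ! i3) $$ (i1, i2) \<and> (P ! i3) $$ (i1, i2) \<le> 1) \<and>
     (\<forall>i<n. \<forall>k<n. (\<Sum>j<n. (L_transform n (complex_tensor P) ! i) $$ (j, k)) = 1)"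

text \<open>
  With 0-based \<open>p\<close> and \<open>q\<close>, the three cases of the Hankel part are \<open>(p+1) + (q+1) \<le> n\<close>,
  \<open>(p+1) + (q+1) = n + 1\<close> and \<open>(p+1) + (q+1) \<ge> n + 2\<close>; the slice numbers are lowered by one.
\<close>

definition hankel_block :: "nat \<Rightarrow> complex tensor \<Rightarrow> nat \<Rightarrow> nat \<Rightarrow> complex mat" where
  "hankel_block n A p q =
     (if p + q + 2 \<le> n then A ! (p + q + 1)
      else if p + q + 2 = n + 1 then 0\<^sub>m n n
      else A ! (2 * n - 1 - p - q))"

definition mat_block :: "nat \<Rightarrow> complex tensor \<Rightarrow> nat \<Rightarrow> nat \<Rightarrow> complex mat" where
  "mat_block n A p q = A ! nat \<bar>int p - int q\<bar> + hankel_block n A p q"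

definition tensor_mat :: "nat \<Rightarrow> complex tensor \<Rightarrow> complex mat" where
  "tensor_mat n A = Matrix.mat (n * n) (n * n)
     (\<lambda>(r, s). mat_block n A (r div n) (s div n) $$ (r mod n, s mod n))"

definition mat_index :: "complex mat \<Rightarrow> nat" where
  "mat_index A = (LEAST k. vec_space.rank (dim_row A) (A ^\<^sub>m k)
     = vec_space.rank (dim_row A) (A ^\<^sub>m (k + 1)))"

definition tensor_index :: "nat \<Rightarrow> complex tensor \<Rightarrow> nat" where
  "tensor_index n A = mat_index (tensor_mat n A)"

definition is_drazin_inverse :: "nat \<Rightarrow> complex tensor \<Rightarrow> complex tensor \<Rightarrow> bool" where
  "is_drazin_inverse n A X \<longleftrightarrow> X \<in> carrier_tensor n \<and>
     cprod n (cpower n A (tensor_index n A + 1)) X = cpower n A (tensor_index n A) \<and>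
     cprod n (cprod n X A) X = X \<and>
     cprod n A X = cprod n X A"

definition is_group_inverse :: "nat \<Rightarrow> complex tensor \<Rightarrow> complex tensor \<Rightarrow> bool" where
  "is_group_inverse n A X \<longleftrightarrow> tensor_index n A = 1 \<and> is_drazin_inverse n A X"

end

theory Submission
  imports Defs "HOL-Analysis.Topology_Euclidean_Space"
begin

text \<open>
  The condition on the column sums is imposed on every transformed slice, and this leaves a transition
  tensor very little freedom.  The entries of the transformation matrix are \<open>M k 0 = 1\<close> and
  \<open>M k l = 2 * cos (k * l * pi / n)\<close> for \<open>l > 0\<close> (lemma \<open>M_matrix_index\<close>), so the weights of a slice
  \<open>l > 0\<close> in the transformed slices 0 and 1 differ strictly.  Because the entries of the tensor are
  nonnegative, equal column sums in these two slices force all frontal slices but the first to be zero,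
  and the first one to be a column-stochastic matrix \<open>Q\<close> (lemma \<open>transition_tensor_first_slice\<close>).
  
  On tensors that are supported on the first slice, the C-product is the matrix product, the identity
  tensor is the identity matrix, and \<open>mat\<close> gives a block diagonal matrix with equal blocks.  So the
  theorem reduces to the fact that \<open>B = 1 - Q\<close> is a singular matrix with a group inverse.  This
  reduction needs the C-product and the identity tensor to be uniquely determined by their transforms,
  that is, \<open>M\<close> to be injective, which is an interpolation argument with Chebyshev polynomials
  (lemma \<open>M_matrix_injective\<close>).
  
  The group inverse of \<open>B\<close> comes from ergodic theory: the powers of \<open>Q\<close> are bounded, a limit point \<open>E\<close> of
  their averages is the projection onto the fixed vectors of \<open>Q\<close>, the matrix \<open>B + E\<close> is invertible, and
  its inverse \<open>Y\<close> yields the group inverse \<open>Y B Y\<close> (lemma \<open>power_bounded_imp_group_inverse\<close>).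
  Moreover \<open>B = B B X\<close> for the group inverse \<open>X\<close>, so \<open>B\<close> and its square have the same rank, and \<open>B\<close> is
  singular because its columns sum to 0: the index is exactly 1 (lemma \<open>mat_index_eq_1\<close>).
\<close>

text \<open>The infix \<open>$\<close> is reserved for entries of vectors with a dimension given by a number.\<close>

no_notation vec_nth (infixl "$" 90)

section \<open>Entrywise limits of matrices\<close>

definition mat_tendsto :: "nat \<Rightarrow> (nat \<Rightarrow> complex mat) \<Rightarrow> complex mat \<Rightarrow> bool" where
  "mat_tendsto n X L \<longleftrightarrow> (\<forall>N. X N \<in> carrier_mat n n) \<and> L \<in> carrier_mat n n \<and>
     (\<forall>i<n. \<forall>j<n. (\<lambda>N. X N $$ (i, j)) \<longlonglongrightarrow> L $$ (i, j))"

lemma mat_tendsto_const: "A \<in> carrier_mat n n \<Longrightarrow> mat_tendsto n (\<lambda>N. A) A"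
  by (simp add: mat_tendsto_def)

lemma mat_tendsto_mult:
  assumes "mat_tendsto n X L" "mat_tendsto n Y K"
  shows "mat_tendsto n (\<lambda>N. X N * Y N) (L * K)"
proof -
  have d: "\<And>N. dim_row (X N) = n" "\<And>N. dim_col (X N) = n" "\<And>N. dim_row (Y N) = n"
    "\<And>N. dim_col (Y N) = n" "dim_row L = n" "dim_col L = n" "dim_row K = n" "dim_col K = n"
    using assms by (auto simp: mat_tendsto_def)
  have "(\<lambda>N. (X N * Y N) $$ (i, j)) \<longlonglongrightarrow> (L * K) $$ (i, j)" if "i < n" "j < n" for i j
    using assms that
    by (auto simp: d scalar_prod_def mat_tendsto_def intro!: tendsto_sum tendsto_mult)
  then show ?thesis
    using d by (auto simp: mat_tendsto_def)
qed

lemma mat_tendsto_unique: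
  assumes "mat_tendsto n X L" "mat_tendsto n X K"
  shows "L = K"
proof (rule eq_matI)
  fix i j assume "i < dim_row K" "j < dim_col K"
  then have "(\<lambda>N. X N $$ (i, j)) \<longlonglongrightarrow> L $$ (i, j)" "(\<lambda>N. X N $$ (i, j)) \<longlonglongrightarrow> K $$ (i, j)"
    using assms by (auto simp: mat_tendsto_def)
  then show "L $$ (i, j) = K $$ (i, j)" by (rule LIMSEQ_unique)
qed (use assms in \<open>auto simp: mat_tendsto_def\<close>)

text \<open>
  There are finitely many entries, so Bolzano-Weierstrass can be applied to them one after the other,
  each time passing to a further subsequence.
\<close>

lemma entrywise_bounded_imp_convergent_subsequence:
  fixes X :: "nat \<Rightarrow> complex mat"
  assumes "\<And>N. X N \<in> carrier_mat n n"
    and bound: "\<And>N i j. i < n \<Longrightarrow> j < n \<Longrightarrow> norm (X N $$ (i, j)) \<le> c"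
  shows "\<exists>r L. strict_mono (r :: nat \<Rightarrow> nat) \<and> mat_tendsto n (X \<circ> r) L"
proof -
  have "\<exists>r. strict_mono (r :: nat \<Rightarrow> nat) \<and> (\<forall>p\<in>I. convergent (\<lambda>N. X (r N) $$ p))"
    if "finite I" "I \<subseteq> {..<n} \<times> {..<n}" for I
    using that
  proof (induction I rule: finite_induct)
    case empty
    show ?case by (auto intro: exI[of _ id] simp: strict_mono_def)
  next
    case (insert p I)
    then obtain r where r: "strict_mono r" "\<forall>q\<in>I. convergent (\<lambda>N. X (r N) $$ q)"
      by auto
    have "bounded (range (\<lambda>N. X (r N) $$ p))"
      using bound[of "fst p" "snd p"] insert.prems by (auto simp: bounded_iff intro!: exI[of _ c])
    then obtain l s where s: "strict_mono (s :: nat \<Rightarrow> nat)" "((\<lambda>N. X (r N) $$ p) \<circ> s) \<longlonglongrightarrow> l"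
      using bounded_imp_convergent_subsequence by blast
    have "convergent (\<lambda>N. X ((r \<circ> s) N) $$ q)" if "q \<in> insert p I" for q
    proof (cases "q = p")
      case True
      then show ?thesis using s(2) by (auto simp: convergent_def o_def)
    next
      case False
      then have "convergent ((\<lambda>N. X (r N) $$ q) \<circ> s)"
        using r(2) that s(1) by (intro convergent_subseq_convergent) auto
      then show ?thesis by (simp add: o_def)
    qed
    then show ?case
      using strict_mono_o[OF r(1) s(1)] by blast
  qed
  from this[of "{..<n} \<times> {..<n}"] obtain r where
    r: "strict_mono r" "\<forall>p\<in>{..<n} \<times> {..<n}. convergent (\<lambda>N. X (r N) $$ p)"
    by auto
  define L where "L = Matrix.mat n n (\<lambda>p. lim (\<lambda>N. X (r N) $$ p))"
  have "mat_tendsto n (X \<circ> r) L"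
    using assms(1) r(2) by (auto simp: mat_tendsto_def L_def convergent_LIMSEQ_iff)
  then show ?thesis using r(1) by blast
qed

section \<open>Sums of powers\<close>

primrec power_sum :: "nat \<Rightarrow> 'a::semiring_1 mat \<Rightarrow> nat \<Rightarrow> 'a mat" where
  "power_sum n P 0 = 0\<^sub>m n n"
| "power_sum n P (Suc N) = power_sum n P N + P ^\<^sub>m N"

lemma power_sum_carrier [simp]: "P \<in> carrier_mat n n \<Longrightarrow> power_sum n P N \<in> carrier_mat n n"
  by (induction N) (auto simp: pow_carrier_mat)

lemma power_sum_dim [simp]:
  "P \<in> carrier_mat n n \<Longrightarrow> dim_row (power_sum n P N) = n"
  "P \<in> carrier_mat n n \<Longrightarrow> dim_col (power_sum n P N) = n"
  using power_sum_carrier by blast+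

lemma pow_mat_Suc_left:
  assumes P: "(P :: 'a::semiring_1 mat) \<in> carrier_mat n n"
  shows "P * P ^\<^sub>m N = P ^\<^sub>m Suc N"
proof (induction N)
  case (Suc N)
  have "P * P ^\<^sub>m Suc N = (P * P ^\<^sub>m N) * P"
    using P by (simp add: assoc_mult_mat[of _ n n _ n _ n] pow_carrier_mat)
  then show ?case using Suc by simp
qed (use P in simp)

lemma power_sum_commute:
  assumes P: "(P :: 'a::semiring_1 mat) \<in> carrier_mat n n"
  shows "P * power_sum n P N = power_sum n P N * P"
proof (induction N)
  case (Suc N)
  then show ?case
    using P pow_mat_Suc_left[OF P, of N]
    by (simp add: mult_add_distrib_mat[of _ n n _ n] add_mult_distrib_mat[of _ n n _ _ n] pow_carrier_mat)
qed (use P in simp)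

text \<open>
  In additive notation \<open>P S + 1 = S + P^N\<close> for \<open>S = 1 + P + ... + P^(N-1)\<close>, two ways of writing the sum
  with one more power.  It is stated for entries because that is where limits are taken.
\<close>

lemma power_sum_telescope:
  assumes P: "(P :: 'a::ring_1 mat) \<in> carrier_mat n n" and ij: "i < n" "j < n"
  shows "(P * power_sum n P N) $$ (i, j) =
     power_sum n P N $$ (i, j) + (P ^\<^sub>m N) $$ (i, j) - 1\<^sub>m n $$ (i, j)"
proof (induction N)
  case (Suc N)
  have "(P * power_sum n P (Suc N)) $$ (i, j) =
      (P * power_sum n P N) $$ (i, j) + (P ^\<^sub>m Suc N) $$ (i, j)"
    using P ij pow_mat_Suc_left[OF P, of N] pow_carrier_mat[OF P, of N]
    by (simp add: mult_add_distrib_mat[of _ n n _ n] del: index_mult_mat(1))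
  then show ?case
    using Suc P ij pow_carrier_mat[OF P, of N] by (simp del: pow_mat.simps index_mult_mat(1))
qed (use P ij in auto)

lemma power_sum_fixed_vector:
  assumes P: "(P :: 'a::comm_ring_1 mat) \<in> carrier_mat n n" and v: "v \<in> carrier_vec n"
    and fix_v: "P *\<^sub>v v = v"
  shows "power_sum n P N *\<^sub>v v = of_nat N \<cdot>\<^sub>v v"
proof (induction N)
  case 0
  then show ?case using v by (auto intro!: eq_vecI)
next
  case (Suc N)
  have "P ^\<^sub>m N *\<^sub>v v = v"
  proof (induction N)
    case (Suc N)
    then show ?case
      using P v fix_v by (simp add: assoc_mult_mat_vec[of _ n n _ n] pow_carrier_mat)
  qed (use P v in simp)
  then show ?case
    using Suc P v
    by (simp add: add_mult_distrib_mat_vec[of _ n n] pow_carrier_mat add_smult_distrib_vec[symmetric] )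
       (auto intro!: eq_vecI simp: algebra_simps)
qed

lemma smult_mat_mult_vec:
  fixes a :: "'a::comm_semiring_0"
  assumes "A \<in> carrier_mat nr nc" "v \<in> carrier_vec nc"
  shows "(a \<cdot>\<^sub>m A) *\<^sub>v v = a \<cdot>\<^sub>v (A *\<^sub>v v)"
  using assms by (intro eq_vecI) (auto simp: scalar_prod_def sum_distrib_left mult.assoc)

lemma norm_power_sum_le:
  fixes P :: "complex mat"
  assumes P: "P \<in> carrier_mat n n" and ij: "i < n" "j < n"
    and bound: "\<And>k. norm ((P ^\<^sub>m k) $$ (i, j)) \<le> c"
  shows "norm (power_sum n P N $$ (i, j)) \<le> of_nat N * c"
proof (induction N)
  case (Suc N)
  have "norm (power_sum n P (Suc N) $$ (i, j)) \<le>
      norm (power_sum n P N $$ (i, j)) + norm ((P ^\<^sub>m N) $$ (i, j))"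
    using P ij pow_carrier_mat[OF P, of N] by (auto intro: norm_triangle_ineq)
  then show ?case using Suc bound[of N] by (simp add: algebra_simps)
qed (use ij in auto)

section \<open>The group inverse of 1 - P for power-bounded P\<close>

text \<open>
  The ergodic projection onto the fixed space of \<open>P\<close>.  It is a limit point of the averages
  \<open>Q\<^sub>N = (1 + P + ... + P^N) / (N + 1)\<close>, which have bounded entries.  By telescoping,
  \<open>P Q\<^sub>N - Q\<^sub>N = (P^(N+1) - 1) / (N + 1)\<close> tends to 0, so the limit \<open>E\<close> satisfies \<open>P E = E\<close>.  Every
  \<open>Q\<^sub>N\<close> commutes with \<open>P\<close> and fixes the fixed vectors of \<open>P\<close>, and both properties survive in the limit.
  The columns of \<open>E\<close> are fixed vectors, hence \<open>E E = E\<close>.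
\<close>

lemma power_bounded_cesaro_projection:
  fixes P :: "complex mat"
  assumes P: "P \<in> carrier_mat n n"
    and bound: "\<And>k i j. i < n \<Longrightarrow> j < n \<Longrightarrow> norm ((P ^\<^sub>m k) $$ (i, j)) \<le> c"
  obtains E where "E \<in> carrier_mat n n" "P * E = E" "E * P = E" "E * E = E"
    "\<And>v. v \<in> carrier_vec n \<Longrightarrow> P *\<^sub>v v = v \<Longrightarrow> E *\<^sub>v v = v"
proof -
  define Q where "Q N = (1 / of_nat (Suc N)) \<cdot>\<^sub>m power_sum n P (Suc N)" for N
  have Q: "Q N \<in> carrier_mat n n" for N
    unfolding Q_def using P by (intro smult_carrier_mat power_sum_carrier)
  have "norm (Q N $$ (i, j)) \<le> c" if "i < n" "j < n" for N i j
  proof -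
    have "norm (Q N $$ (i, j)) = norm (power_sum n P (Suc N) $$ (i, j)) / of_nat (Suc N)"
      using that P by (simp add: Q_def norm_divide pow_carrier_mat norm_mult del: power_sum.simps of_nat_Suc)
    also have "\<dots> \<le> c"
      using norm_power_sum_le[OF P that bound[OF that], of "Suc N"]
      by (simp add: field_simps del: power_sum.simps of_nat_Suc)
    finally show ?thesis .
  qed
  then obtain r E where r: "strict_mono r" and E: "mat_tendsto n (Q \<circ> r) E"
    using entrywise_bounded_imp_convergent_subsequence[of Q n c] Q by blast
  have E': "E \<in> carrier_mat n n" using E by (simp add: mat_tendsto_def)
  have PE: "P * E = E"
  proof (rule mat_tendsto_unique)
    show "mat_tendsto n (\<lambda>N. P * (Q \<circ> r) N) (P * E)"
      by (rule mat_tendsto_mult[OF mat_tendsto_const[OF P] E])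
    have "(\<lambda>N. (P * (Q \<circ> r) N) $$ (i, j)) \<longlonglongrightarrow> E $$ (i, j)" if ij: "i < n" "j < n" for i j
    proof -
      \<comment> \<open>what telescoping leaves over; it is of order \<open>1 / N\<close> because the powers are bounded\<close>
      define e where "e N = ((P ^\<^sub>m Suc N) $$ (i, j) - 1\<^sub>m n $$ (i, j)) / of_nat (Suc N)" for N
      have PQ: "(P * Q N) $$ (i, j) = Q N $$ (i, j) + e N" for N
      proof -
        have "(P * Q N) $$ (i, j) = (P * power_sum n P (Suc N)) $$ (i, j) / of_nat (Suc N)"
          using P ij power_sum_carrier[OF P, of "Suc N"]
          by (simp add: Q_def mult_smult_distrib[of P n n _ n] del: power_sum.simps of_nat_Suc index_mult_mat(1))
        then show ?thesis
          using P ij power_sum_carrier[OF P, of "Suc N"]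
          unfolding power_sum_telescope[OF P ij]
          by (simp add: Q_def e_def field_simps del: power_sum.simps of_nat_Suc index_mult_mat(1) pow_mat.simps)
      qed
      have "norm (e N) \<le> (c + 1) * inverse (real (Suc N))" for N
      proof -
        have "norm ((P ^\<^sub>m Suc N) $$ (i, j) - 1\<^sub>m n $$ (i, j)) \<le> c + 1"
          using bound[OF ij, of "Suc N"] ij
          by (intro order_trans[OF norm_triangle_ineq4] add_mono) auto
        then show ?thesis
          by (simp add: e_def norm_divide divide_right_mono flip: divide_inverse del: of_nat_Suc pow_mat.simps)
      qed
      then have "e \<longlonglongrightarrow> 0"
        using LIMSEQ_inverse_real_of_nat
        by (intro Lim_null_comparison[of e "\<lambda>N. (c + 1) * inverse (real (Suc N))"] always_eventually allI)
           (auto intro: tendsto_mult_right_zero)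
      then have "(\<lambda>N. e (r N)) \<longlonglongrightarrow> 0"
        using LIMSEQ_subseq_LIMSEQ[OF _ r] by (auto simp: o_def)
      moreover have "(\<lambda>N. Q (r N) $$ (i, j)) \<longlonglongrightarrow> E $$ (i, j)"
        using E ij by (simp add: mat_tendsto_def)
      ultimately show ?thesis
        using tendsto_add by (fastforce simp: PQ simp del: index_mult_mat(1))
    qed
    then show "mat_tendsto n (\<lambda>N. P * (Q \<circ> r) N) E"
      using P Q E' by (simp add: mat_tendsto_def del: index_mult_mat(1))
  qed
  have EP: "E * P = E"
  proof -
    have "P * Q N = Q N * P" for N
      using P power_sum_commute[OF P, of "Suc N"] power_sum_carrier[OF P, of "Suc N"]
      by (simp add: Q_def mult_smult_distrib[of P n n _ n] mult_smult_assoc_mat[of _ n n P n] del: power_sum.simps of_nat_Suc)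
    then have "mat_tendsto n (\<lambda>N. P * (Q \<circ> r) N) (E * P)"
      using mat_tendsto_mult[OF E mat_tendsto_const[OF P]] by simp
    then have "E * P = P * E"
      using mat_tendsto_mult[OF mat_tendsto_const[OF P] E] mat_tendsto_unique by blast
    then show ?thesis using PE by simp
  qed
  have Q_fix: "Q N *\<^sub>v v = v" if "v \<in> carrier_vec n" "P *\<^sub>v v = v" for v N
  proof -
    have "Q N *\<^sub>v v = (1 / of_nat (Suc N)) \<cdot>\<^sub>v (power_sum n P (Suc N) *\<^sub>v v)"
      using P that(1) power_sum_carrier[OF P, of "Suc N"]
      unfolding Q_def by (intro smult_mat_mult_vec)
    then show ?thesis
      using that(1) unfolding power_sum_fixed_vector[OF P that]
      by (simp add: smult_smult_assoc del: of_nat_Suc)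
  qed
  have fixed: "E *\<^sub>v v = v" if v: "v \<in> carrier_vec n" and "P *\<^sub>v v = v" for v
  proof (rule eq_vecI)
    fix i assume "i < dim_vec v"
    then have i: "i < n" using v by auto
    have "(\<lambda>N. (Q (r N) *\<^sub>v v) $ i) \<longlonglongrightarrow> (E *\<^sub>v v) $ i"
      using E i v carrier_matD[OF Q] carrier_matD[OF E'] unfolding mat_tendsto_def
      by (simp add: scalar_prod_def) (intro tendsto_sum tendsto_mult tendsto_const, auto)
    then show "(E *\<^sub>v v) $ i = v $ i"
      by (simp add: Q_fix[OF that] LIMSEQ_const_iff)
  qed (use E' v in auto)
  have "E * E = E"
  proof (rule mat_col_eqI)
    fix j assume "j < dim_col E"
    then have j: "j < n" using E' by auto
    have "P *\<^sub>v col E j = col (P * E) j"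
      by (rule col_mult2[OF P E' j, symmetric])
    then have "E *\<^sub>v col E j = col E j"
      using PE E' j by (intro fixed) auto
    then show "col (E * E) j = col E j"
      unfolding col_mult2[OF E' E' j] .
  qed (use E' in auto)
  then show thesis
    using that E' PE EP fixed by blast
qed


text \<open>
  With the ergodic projection \<open>E\<close> of \<open>P\<close>, the matrix \<open>F = B + E\<close> is nonsingular: if \<open>F v = 0\<close>, then
  multiplying by \<open>E\<close> gives \<open>E v = 0\<close>, so \<open>B v = 0\<close>, that is \<open>P v = v\<close>, and therefore \<open>v = E v = 0\<close>.  (For a
  stochastic matrix, the inverse of \<open>F\<close> is the fundamental matrix of Kemeny and Snell.)  Since
  \<open>B F = B B = F B\<close>, the inverse \<open>Y\<close> of \<open>F\<close> satisfies \<open>Y B B = B = B B Y\<close>, and in any monoid these two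
  equations make \<open>Y B Y\<close> a group inverse of \<open>B\<close>.
\<close>

lemma power_bounded_imp_group_inverse:
  fixes P B :: "complex mat"
  assumes P: "P \<in> carrier_mat n n"
    and bound: "\<And>k i j. i < n \<Longrightarrow> j < n \<Longrightarrow> norm ((P ^\<^sub>m k) $$ (i, j)) \<le> c"
    and B_def: "B = 1\<^sub>m n - P"
  shows "\<exists>X \<in> carrier_mat n n. B * B * X = B \<and> X * B * X = X \<and> B * X = X * B"
proof -
  obtain E where E: "E \<in> carrier_mat n n" and PE: "P * E = E" "E * P = E" and EE: "E * E = E"
    and fixed: "\<And>v. v \<in> carrier_vec n \<Longrightarrow> P *\<^sub>v v = v \<Longrightarrow> E *\<^sub>v v = v"
    using power_bounded_cesaro_projection[OF P bound] by metis
  define F where "F = B + E"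
  have B: "B \<in> carrier_mat n n" and F: "F \<in> carrier_mat n n"
    using P E by (auto simp: B_def F_def)
  have BE: "B * E = 0\<^sub>m n n" "E * B = 0\<^sub>m n n"
    using P E PE by (auto simp: B_def minus_mult_distrib_mat[of _ n n _ _ n] mult_minus_distrib_mat[of _ n n _ n])
  have BF: "B * F = B * B" "F * B = B * B"
    using B E BE by (auto simp: F_def mult_add_distrib_mat[of _ n n _ n] add_mult_distrib_mat[of _ n n _ _ n])
  have "det F \<noteq> 0"
  proof
    assume "det F = 0"
    then obtain v where v: "v \<in> carrier_vec n" "v \<noteq> 0\<^sub>v n" and Fv: "F *\<^sub>v v = 0\<^sub>v n"
      using det_0_iff_vec_prod_zero[OF F] by auto
    have split: "F *\<^sub>v v = B *\<^sub>v v + E *\<^sub>v v"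
      using B E v by (simp add: F_def add_mult_distrib_mat_vec[of _ n n])
    have "E * F = E"
      using B E BE EE by (simp add: F_def mult_add_distrib_mat[of _ n n _ n])
    then have "E *\<^sub>v v = E *\<^sub>v (F *\<^sub>v v)"
      using assoc_mult_mat_vec[OF E F v(1)] by simp
    then have Ev: "E *\<^sub>v v = 0\<^sub>v n"
      using E Fv by (auto intro!: eq_vecI)
    then have "B *\<^sub>v v = 0\<^sub>v n"
      using split Fv B v by (metis mult_mat_vec_carrier right_zero_vec)
    moreover have "B *\<^sub>v v = v - P *\<^sub>v v"
      using P v by (simp add: B_def minus_mult_distrib_mat_vec[of _ n n])
    ultimately have vPv: "v - P *\<^sub>v v = 0\<^sub>v n" by simp
    have "P *\<^sub>v v = v"
    proof (rule eq_vecI)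
      fix i assume "i < dim_vec v"
      then show "(P *\<^sub>v v) $ i = v $ i"
        using arg_cong[OF vPv, of "\<lambda>u. u $ i"] P v(1) by simp
    qed (use P v in auto)
    then show False
      using fixed v Ev by auto
  qed
  then obtain Y where Y: "Y \<in> carrier_mat n n" "Y * F = 1\<^sub>m n" "F * Y = 1\<^sub>m n"
    using det_non_zero_imp_unit[OF F, of "()"] unfolding Units_def ring_mat_def by auto
  note assoc = assoc_mult_mat[of _ n n _ n _ n]
  have YBB: "Y * (B * B) = B"
    using Y B F by (simp add: assoc[symmetric] flip: BF(2))
  have "B * (B * Y) = B * F * Y" using Y B by (simp add: assoc BF(1))
  also have "\<dots> = B" using Y B F by (simp add: assoc)
  finally have BBY: "B * (B * Y) = B" .
  have "Y * B = Y * (B * (B * Y))" by (simp add: BBY)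
  also have "\<dots> = Y * (B * B) * Y" using Y B by (simp add: assoc)
  finally have comm: "Y * B = B * Y" using YBB by simp
  have idem: "B * Y * (B * Y) = B * Y"
  proof -
    have "B * Y * (B * Y) = Y * (B * (B * Y))"
      using Y B by (simp add: assoc flip: comm)
    then show ?thesis by (simp add: BBY comm)
  qed
  define X where "X = Y * (B * Y)"
  have X: "X \<in> carrier_mat n n" using Y B by (simp add: X_def)
  have BX: "B * X = B * Y"
    using Y B idem by (simp add: X_def assoc)
  have XB: "X * B = B * Y"
  proof -
    have "X * B = Y * (B * (Y * B))" using Y B by (simp add: X_def assoc)
    then show ?thesis by (simp add: BBY comm)
  qed
  have "B * B * X = B"
    using X B Y BX BBY by (simp add: assoc)
  moreover have "X * B * X = X"
  proof -
    have "X * B * X = X * (B * X)" using X B by (simp add: assoc)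
    also have "\<dots> = Y * (B * Y * (B * Y))" using Y B unfolding BX by (simp add: X_def assoc)
    finally show ?thesis by (simp add: idem X_def)
  qed
  ultimately show ?thesis using X BX XB by auto
qed

section \<open>The index of a block diagonal matrix\<close>

text \<open>
  The factorization \<open>K = K K C\<close> puts the column space of \<open>K\<close> into that of \<open>K K\<close>, so the ranks agree from
  exponent 1 on; singularity is what excludes the index 0.
\<close>

lemma mat_index_eq_1:
  assumes K: "K \<in> carrier_mat m m" and C: "C \<in> carrier_mat m m"
    and factor: "K * K * C = K" and singular: "det K = 0"
  shows "mat_index K = 1"
proof -
  interpret vec_space "TYPE(complex)" m .
  have "col_space (K * K) = col_space K"
  proof (intro equalityI subsetI)
    fix y assume "y \<in> col_space (K * K)"
    then obtain x where x: "x \<in> carrier_vec m" "K * K *\<^sub>v x = y"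
      using K by (auto simp: col_space_eq[of _ m])
    then show "y \<in> col_space K"
      using K by (auto simp: col_space_eq[of _ m] assoc_mult_mat_vec[of _ m m _ m] intro!: bexI[of _ "K *\<^sub>v x"])
  next
    fix y assume "y \<in> col_space K"
    then obtain x where x: "x \<in> carrier_vec m" "K *\<^sub>v x = y"
      using K by (auto simp: col_space_eq[of _ m])
    have "K * K *\<^sub>v (C *\<^sub>v x) = y"
      using assoc_mult_mat_vec[of "K * K" m m C m x] K C x by (simp add: factor)
    then show "y \<in> col_space (K * K)"
      using K C x(1) by (auto simp: col_space_eq[of _ m] intro!: bexI[of _ "C *\<^sub>v x"])
  qed
  then have rank_sq: "rank (K * K) = rank K"
    by (simp add: rank_def col_space_def)
  have "rank K < m" using det_zero_low_rank[OF K singular] .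
  moreover have "rank (1\<^sub>m m) = m"
    by (rule low_rank_det_zero) auto
  ultimately show ?thesis
    using K rank_sq unfolding mat_index_def
    by (intro Least_equality) (auto simp: not_less_eq_eq[symmetric] Suc_le_eq  intro!: Nat.gr0I)
qed

definition block_diag :: "nat \<Rightarrow> 'a::zero mat \<Rightarrow> 'a mat" where
  "block_diag n B = Matrix.mat (n * n) (n * n)
     (\<lambda>(r, s). if r div n = s div n then B $$ (r mod n, s mod n) else 0)"

lemma block_diag_carrier [simp]: "block_diag n B \<in> carrier_mat (n * n) (n * n)"
  by (simp add: block_diag_def)

text \<open>
  Only the indices of one block contribute; this is how sums over all \<open>n * n\<close> indices reduce to sums
  over the \<open>n\<close> indices inside a block.
\<close>

lemma sum_over_block:
  fixes f :: "nat \<Rightarrow> 'a::comm_monoid_add"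
  assumes "q < n"
  shows "(\<Sum>t = 0..<n * n. if t div n = q then f (t mod n) else 0) = (\<Sum>i = 0..<n. f i)"
proof -
  have "(\<Sum>i = 0..<n. f i) = (\<Sum>t \<in> {t \<in> {0..<n * n}. t div n = q}. f (t mod n))"
  proof (rule sum.reindex_bij_witness[where i = "\<lambda>t. t mod n" and j = "\<lambda>i. q * n + i"])
    fix i assume i: "i \<in> {0..<n}"
    have "Suc q * n \<le> n * n" using assms by (intro mult_right_mono) auto
    then show "q * n + i \<in> {t \<in> {0..<n * n}. t div n = q}" using i by auto
  qed (use assms in auto)
  then show ?thesis
    by (subst sum.inter_filter[symmetric]) auto
qed

lemma block_diag_mult:
  fixes B C :: "'a::semiring_0 mat"
  assumes "B \<in> carrier_mat n n" "C \<in> carrier_mat n n"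
  shows "block_diag n B * block_diag n C = block_diag n (B * C)"
proof (rule eq_matI)
  fix r s assume "r < dim_row (block_diag n (B * C))" "s < dim_col (block_diag n (B * C))"
  then have r: "r < n * n" and s: "s < n * n" by (auto simp: block_diag_def)
  then have n: "0 < n" and q: "r div n < n" by (auto simp: less_mult_imp_div_less intro: Nat.gr0I)
  have "(block_diag n B * block_diag n C) $$ (r, s) =
      (\<Sum>t = 0..<n * n. if t div n = r div n
         then (if r div n = s div n then B $$ (r mod n, t mod n) * C $$ (t mod n, s mod n) else 0) else 0)"
    using r s by (auto simp: block_diag_def scalar_prod_def intro!: sum.cong)
  also have "\<dots> = (\<Sum>i = 0..<n. if r div n = s div n then B $$ (r mod n, i) * C $$ (i, s mod n) else 0)"
    by (rule sum_over_block[OF q])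
  also have "\<dots> = block_diag n (B * C) $$ (r, s)"
    using r s n assms by (auto simp: block_diag_def scalar_prod_def intro!: sum.cong)
  finally show "(block_diag n B * block_diag n C) $$ (r, s) = block_diag n (B * C) $$ (r, s)" .
qed (auto simp: block_diag_def)

text \<open>
  If the columns of \<open>B\<close> sum to 0, then so do those of the block diagonal matrix, which means that the
  all-ones vector lies in the kernel of its transpose.
\<close>

lemma det_block_diag_eq_0:
  fixes B :: "'a::idom mat"
  assumes "0 < n" and B: "B \<in> carrier_mat n n" and sums: "\<And>k. k < n \<Longrightarrow> (\<Sum>j = 0..<n. B $$ (j, k)) = 0"
  shows "det (block_diag n B) = 0"
proof -
  define u :: "'a Matrix.vec" where "u = Matrix.vec (n * n) (\<lambda>_. 1)"
  have "(transpose_mat (block_diag n B) *\<^sub>v u) $ s = 0" if s: "s < n * n" for s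
  proof -
    have "(transpose_mat (block_diag n B) *\<^sub>v u) $ s =
        (\<Sum>t = 0..<n * n. if t div n = s div n then B $$ (t mod n, s mod n) else 0)"
      using s by (auto simp: block_diag_def u_def scalar_prod_def intro!: sum.cong)
    also have "\<dots> = 0"
      using s sums[of "s mod n"] assms(1) by (subst sum_over_block) (auto simp: less_mult_imp_div_less)
    finally show ?thesis .
  qed
  then have "transpose_mat (block_diag n B) *\<^sub>v u = 0\<^sub>v (n * n)"
    by (intro eq_vecI) (auto simp: block_diag_def)
  moreover have "u \<in> carrier_vec (n * n)" by (simp add: u_def)
  moreover have "u \<noteq> 0\<^sub>v (n * n)"
  proof
    assume "u = 0\<^sub>v (n * n)"
    then have "u $ 0 = 0\<^sub>v (n * n) $ 0" by simp
    then show False using assms(1) by (simp add: u_def)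
  qed
  ultimately have "det (transpose_mat (block_diag n B)) = 0"
    using det_0_iff_vec_prod_zero[of "transpose_mat (block_diag n B)" "n * n"] by auto
  then show ?thesis
    using det_transpose[OF block_diag_carrier] by metis
qed


section \<open>Chebyshev polynomials and the transformation matrix\<close>

fun chebyshev :: "nat \<Rightarrow> complex poly" where
  "chebyshev 0 = 1"
| "chebyshev (Suc 0) = [:0, 1:]"
| "chebyshev (Suc (Suc l)) = [:0, 2:] * chebyshev (Suc l) - chebyshev l"

lemma poly_chebyshev_cos: "poly (chebyshev l) (of_real (cos t)) = of_real (cos (real l * t))"
proof (induction l rule: chebyshev.induct)
  case (3 l)
  have "cos (real (Suc (Suc l)) * t) + cos (real l * t) = 2 * cos t * cos (real (Suc l) * t)"
    by (simp add: cos_plus_cos algebra_simps add_divide_distrib)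
  then have "cos (real (Suc (Suc l)) * t) = 2 * cos t * cos (real (Suc l) * t) - cos (real l * t)"
    by simp
  then show ?case
    using 3 by (simp del: of_nat_Suc)
qed auto

lemma degree_chebyshev: "degree (chebyshev l) = l"
proof (induction l rule: chebyshev.induct)
  case (3 l)
  have nz: "chebyshev (Suc l) \<noteq> 0" using 3 by auto
  have "degree ([:0, 2:] * chebyshev (Suc l)) = Suc (Suc l)"
    using nz 3 by (subst degree_mult_eq) auto
  moreover have "degree (- chebyshev l) < Suc (Suc l)" using 3 by simp
  ultimately show ?case
    by (metis chebyshev.simps(3) degree_add_eq_left diff_conv_add_uminus)
qed auto

text \<open>
  Compare the coefficients of the highest degree: only the last polynomial contributes to it.
\<close>

lemma graded_polys_independent:
  fixes p :: "nat \<Rightarrow> 'a::idom poly"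
  assumes deg: "\<And>l. degree (p l) = l" and nz: "\<And>l. p l \<noteq> 0"
    and "(\<Sum>l<n. Polynomial.smult (c l) (p l)) = 0" "l < n"
  shows "c l = 0"
  using assms(3,4)
proof (induction n arbitrary: l)
  case (Suc n)
  have "coeff (\<Sum>l<n. Polynomial.smult (c l) (p l)) n = 0"
    by (auto simp: coeff_sum deg coeff_eq_0 intro!: sum.neutral)
  then have "c n * coeff (p n) n = 0"
    using arg_cong[OF Suc.prems(1), of "\<lambda>q. coeff q n"] by simp
  moreover have "coeff (p n) n \<noteq> 0"
    using nz[of n] deg[of n] leading_coeff_neq_0 by metis
  ultimately have "c n = 0" by simp
  then have "(\<Sum>l<n. Polynomial.smult (c l) (p l)) = (\<Sum>l<Suc n. Polynomial.smult (c l) (p l))"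
    by simp
  also have "\<dots> = 0" by (rule Suc.prems(1))
  finally have "l < n \<Longrightarrow> c l = 0" by (rule Suc.IH)
  then show ?case
    using \<open>c n = 0\<close> Suc.prems(2) by (auto simp: less_Suc_eq)
qed simp

text \<open>
  The scaling by \<open>W\<close> and the factor \<open>1 + Z\<close> turn the DCT into plain cosines.  With
  \<open>h = k * pi / (2 * n)\<close>, column \<open>l\<close> of \<open>C (1 + Z)\<close> has in row \<open>k\<close> a multiple of
  \<open>cos ((2 * l + 1) * h) + cos ((2 * l - 1) * h) = 2 * cos (2 * l * h) * cos h\<close>, and
  the \<open>k\<close>-th diagonal entry of \<open>W\<close> is the same multiple of \<open>cos h\<close>.
\<close>

lemma M_matrix_index:
  assumes k: "k < n" and l: "l < n"
  shows "M_matrix n $$ (k, l) = (if l = 0 then 1 else 2 * of_real (cos (real l * (real k * pi / real n))))"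
proof -
  define h where "h = real k * pi / (2 * real n)"
  define s where "s = sqrt ((2 - (if k = 0 then 1 else 0)) / real n)"
  have n: "0 < n" using k by simp
  have h: "0 \<le> h" "h < pi / 2"
    using k n by (auto simp: h_def field_simps)
  have s: "s > 0" using n by (simp add: s_def)
  have nz: "dct_matrix n $$ (j, 0) \<noteq> 0" if "j < n" for j
  proof -
    have "cos (real j * pi / (2 * real n)) > 0"
      using that by (intro cos_gt_zero_pi) (auto simp: field_simps intro: less_le_trans[of _ 0])
    then show ?thesis
      using that by (simp add: dct_matrix_def mult.commute)
  qed
  have W: "W_matrix n \<in> carrier_mat n n" by (simp add: W_matrix_def)
  have "det (W_matrix n) \<noteq> 0"
    using nz by (subst det_upper_triangular[OF _ W])
      (auto simp: W_matrix_def mat_diag_def diag_mat_def upper_triangular_def prod_list_zero_iff)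
  then have "W_matrix n \<in> Units (ring_mat TYPE(complex) n ())"
    by (rule det_non_zero_imp_unit[OF W])
  then obtain V where V: "mat_inverse (W_matrix n) = Some V"
    using mat_inverse(1)[OF W, of "()"] by (cases "mat_inverse (W_matrix n)") auto
  then have WV: "W_matrix n * V = 1\<^sub>m n" and V': "V \<in> carrier_mat n n"
    using mat_inverse(2)[OF W] by auto
  \<comment> \<open>Entries are compared in \<open>W M = C (1 + Z)\<close>, which avoids computing the inverse \<open>V\<close> of \<open>W\<close>.\<close>
  define D where "D = dct_matrix n * (1\<^sub>m n + Z_matrix n)"
  have C: "dct_matrix n \<in> carrier_mat n n" "1\<^sub>m n + Z_matrix n \<in> carrier_mat n n"
    by (auto simp: dct_matrix_def Z_matrix_def)
  have M: "M_matrix n = V * D"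
    using V V' C by (simp add: M_matrix_def D_def assoc_mult_mat[of V n n _ n _ n])
  have D': "D \<in> carrier_mat n n" using C by (simp add: D_def)
  have WM: "W_matrix n * M_matrix n = D"
    using W V' D' WV unfolding M by (simp add: assoc_mult_mat[of _ n n _ n _ n, symmetric])
  have "M_matrix n \<in> carrier_mat n n" using V' D' by (simp add: M)
  then have "W_matrix n * M_matrix n = Matrix.mat n n (\<lambda>(i, j). dct_matrix n $$ (i, 0) * M_matrix n $$ (i, j))"
    unfolding W_matrix_def by (rule mat_diag_mult_left)
  then have "dct_matrix n $$ (k, 0) * M_matrix n $$ (k, l) = D $$ (k, l)"
    using k l by (simp flip: WM)
  moreover have "dct_matrix n $$ (k, 0) = of_real (s * cos h)"
    using k n by (simp add: dct_matrix_def s_def h_def)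
  moreover have "D $$ (k, l) = of_real (s * cos h) *
      (if l = 0 then 1 else 2 * of_real (cos (real l * (real k * pi / real n))))"
  proof -
    have "D $$ (k, l) = (\<Sum>i = 0..<n. dct_matrix n $$ (k, i) *
        ((if i = l then 1 else 0) + (if l = i + 1 then 1 else 0)))"
      using k l C by (auto simp: D_def scalar_prod_def Z_matrix_def intro!: sum.cong)
    also have "\<dots> = dct_matrix n $$ (k, l) + (if l = 0 then 0 else dct_matrix n $$ (k, l - 1))"
    proof -
      have "(if l = i + 1 then 1 else 0 :: complex) = (if i = l - 1 then (if l = 0 then 0 else 1) else 0)" for i
        by auto
      then show ?thesis
        using l by (simp add: distrib_left sum.distrib if_distrib[of "\<lambda>x. _ * x"] cong: if_cong)
    qed
    also have "\<dots> = of_real (s * cos h) *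
      (if l = 0 then 1 else 2 * of_real (cos (real l * (real k * pi / real n))))"
    proof (cases "l = 0")
      case True
      then show ?thesis using k n by (simp add: dct_matrix_def s_def h_def)
    next
      case False
      have ang: "real k * (2 * real l + 1) * pi / (2 * real n) = 2 * real l * h + h"
        "real k * (2 * real (l - 1) + 1) * pi / (2 * real n) = 2 * real l * h - h"
        "real l * (real k * pi / real n) = 2 * real l * h"
        using False n by (auto simp: h_def field_simps of_nat_diff)
      have "cos (2 * real l * h + h) + cos (2 * real l * h - h) = 2 * cos (2 * real l * h) * cos h"
        by (simp add: cos_add cos_diff)
      then have "s * cos (2 * real l * h + h) + s * cos (2 * real l * h - h)
          = s * cos h * (2 * cos (2 * real l * h))"
        by (simp flip: distrib_left)
      then have "dct_matrix n $$ (k, l) + dct_matrix n $$ (k, l - 1)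
          = of_real (s * cos h * (2 * cos (2 * real l * h)))"
        using k l unfolding dct_matrix_def
        by (simp add: ang ang(2)[unfolded One_nat_def] s_def[symmetric] flip: of_real_add of_real_mult)
      then show ?thesis using False ang by simp
    qed
    finally show ?thesis .
  qed
  moreover have "s * cos h \<noteq> 0" using s h cos_gt_zero_pi[of h] by auto
  ultimately show ?thesis
    by (simp add: nz k)
qed

text \<open>
  A vector \<open>c\<close> in the kernel of \<open>M\<close> yields the polynomial \<open>c\<^sub>0 T\<^sub>0 + 2 (c\<^sub>1 T\<^sub>1 + ...)\<close> of degree less
  than \<open>n\<close>, whose value at \<open>cos (k * pi / n)\<close> is entry \<open>k\<close> of \<open>M c\<close>.  It has \<open>n\<close> distinct roots and
  vanishes; Chebyshev polynomials of different degrees being independent, so does \<open>c\<close>.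
\<close>

lemma M_matrix_injective:
  assumes zero: "\<And>k. k < n \<Longrightarrow> (\<Sum>l<n. M_matrix n $$ (k, l) * c l) = 0" and l: "l < n"
  shows "c l = 0"
proof -
  \<comment> \<open>the factor by which row entries of \<open>M\<close> exceed the cosines\<close>
  define d where "d l = (if l = 0 then 1 else 2) * c l" for l
  define p where "p = (\<Sum>l<n. Polynomial.smult (d l) (chebyshev l))"
  define x where "x k = complex_of_real (cos (real k * pi / real n))" for k
  have n: "0 < n" using l by simp
  have "poly p (x k) = 0" if "k < n" for k
  proof -
    have "poly p (x k) = (\<Sum>l<n. M_matrix n $$ (k, l) * c l)"
      using that by (auto simp: p_def poly_sum x_def poly_chebyshev_cos d_def M_matrix_index intro!: sum.cong)
    then show ?thesis using zero that by simp
  qed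
  then have roots: "x ` {..<n} \<subseteq> {y. poly p y = 0}" by auto
  have "inj_on x {..<n}"
  proof (rule inj_onI)
    fix i j assume "i \<in> {..<n}" "j \<in> {..<n}" and xij: "x i = x j"
    then have ij: "i < n" "j < n" by simp_all
    have bounds: "0 \<le> real m * pi / real n" "real m * pi / real n \<le> pi" if "m < n" for m
      using that n by (auto intro!: mult_right_mono simp: pos_divide_le_eq mult.commute[of pi])
    have "cos (real i * pi / real n) = cos (real j * pi / real n)"
      using xij unfolding x_def of_real_eq_iff .
    then have "real i * pi / real n = real j * pi / real n"
      by (rule cos_inj_pi[OF bounds[OF ij(1)] bounds[OF ij(2)]])
    then show "i = j" using n by simp
  qed
  then have card: "card (x ` {..<n}) = n" by (simp add: card_image)
  have "degree p < n"
    unfolding p_def using n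
    by (intro degree_sum_less) (simp_all add: degree_chebyshev del: degree_smult_eq, metis degree_smult_le degree_chebyshev le_less_trans)
  moreover have "n \<le> degree p" if "p \<noteq> 0"
    using card_mono[OF poly_roots_finite[OF that] roots] card card_poly_roots_bound[OF that] by simp
  ultimately have "p = 0" by force
  moreover have "chebyshev l \<noteq> 0" for l
  proof
    assume "chebyshev l = 0"
    then have "l = 0" using degree_chebyshev[of l] by simp
    then show False using \<open>chebyshev l = 0\<close> by simp
  qed
  ultimately have "d l = 0"
    using graded_polys_independent[where p = chebyshev and c = d and n = n and l = l] degree_chebyshev l
    unfolding p_def by blast
  then show ?thesis by (simp add: d_def split: if_splits)
qed


section \<open>Tensors supported on the first slice\<close>

definition first_slice_tensor :: "nat \<Rightarrow> 'a::zero mat \<Rightarrow> 'a tensor" where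
  "first_slice_tensor n Q = Q # replicate (n - 1) (0\<^sub>m n n)"

lemma first_slice_tensor_nth:
  "l < n \<Longrightarrow> first_slice_tensor n Q ! l = (if l = 0 then Q else 0\<^sub>m n n)"
  by (auto simp: first_slice_tensor_def nth_Cons')

lemma length_first_slice_tensor: "0 < n \<Longrightarrow> length (first_slice_tensor n Q) = n"
  by (simp add: first_slice_tensor_def)

lemma first_slice_tensor_carrier:
  "0 < n \<Longrightarrow> Q \<in> carrier_mat n n \<Longrightarrow> first_slice_tensor n Q \<in> carrier_tensor n"
  by (auto simp: carrier_tensor_def first_slice_tensor_def)

lemma carrier_tensor_nth: "A \<in> carrier_tensor n \<Longrightarrow> l < n \<Longrightarrow> A ! l \<in> carrier_mat n n"
  by (auto simp: carrier_tensor_def)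

lemma L_transform_nth:
  "k < n \<Longrightarrow> L_transform n A ! k =
     Matrix.mat n n (\<lambda>(i, j). \<Sum>l<n. M_matrix n $$ (k, l) * (A ! l) $$ (i, j))"
  by (simp add: L_transform_def)

text \<open>
  The first column of \<open>M\<close> consists of ones, so a tensor with a single nonzero slice in front is
  transformed to a tensor with constant slices.  Hence the C-product restricts to the matrix product
  on such tensors.
\<close>

lemma L_transform_first_slice_tensor:
  assumes k: "k < n" and Q: "Q \<in> carrier_mat n n"
  shows "L_transform n (first_slice_tensor n Q) ! k = Q"
proof (rule eq_matI)
  fix i j assume "i < dim_row Q" "j < dim_col Q"
  then have ij: "i < n" "j < n" using Q by auto
  have "(L_transform n (first_slice_tensor n Q) ! k) $$ (i, j) =
      (\<Sum>l<n. M_matrix n $$ (k, l) * (first_slice_tensor n Q ! l) $$ (i, j))"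
    using k ij by (simp add: L_transform_nth)
  also have "\<dots> = (\<Sum>l<n. if l = 0 then Q $$ (i, j) else 0)"
    using k ij by (intro sum.cong) (auto simp: first_slice_tensor_nth M_matrix_index)
  finally show "(L_transform n (first_slice_tensor n Q) ! k) $$ (i, j) = Q $$ (i, j)"
    using k by simp
qed (use k Q in \<open>auto simp: L_transform_nth\<close>)

lemma L_transform_injective:
  assumes A: "A \<in> carrier_tensor n" and B: "B \<in> carrier_tensor n"
    and eq: "\<And>k. k < n \<Longrightarrow> L_transform n A ! k = L_transform n B ! k"
  shows "A = B"
proof (rule nth_equalityI)
  show "length A = length B" using A B by (simp add: carrier_tensor_def)
  fix l assume "l < length A"
  then have l: "l < n" using A by (simp add: carrier_tensor_def)
  show "A ! l = B ! l"
  proof (rule eq_matI)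
    fix i j assume "i < dim_row (B ! l)" "j < dim_col (B ! l)"
    then have ij: "i < n" "j < n" using carrier_tensor_nth[OF B l] by auto
    have "(\<Sum>l<n. M_matrix n $$ (k, l) * ((A ! l) $$ (i, j) - (B ! l) $$ (i, j))) = 0" if k: "k < n" for k
      using arg_cong[OF eq[OF k], of "\<lambda>C. C $$ (i, j)"] k ij
      by (simp add: L_transform_nth right_diff_distrib sum_subtractf)
    from M_matrix_injective[OF this l] show "(A ! l) $$ (i, j) = (B ! l) $$ (i, j)" by simp
  qed (use carrier_tensor_nth[OF A l] carrier_tensor_nth[OF B l] in auto)
qed

lemma cprod_first_slice_tensor:
  assumes n: "0 < n" and B: "B \<in> carrier_mat n n" and C: "C \<in> carrier_mat n n"
  shows "cprod n (first_slice_tensor n B) (first_slice_tensor n C) = first_slice_tensor n (B * C)"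
  unfolding cprod_def
proof (rule the_equality)
  show "first_slice_tensor n (B * C) \<in> carrier_tensor n \<and>
    (\<forall>i<n. L_transform n (first_slice_tensor n (B * C)) ! i =
      L_transform n (first_slice_tensor n B) ! i * L_transform n (first_slice_tensor n C) ! i)"
    using assms by (simp add: first_slice_tensor_carrier L_transform_first_slice_tensor[of _ _ "B * C"]
      L_transform_first_slice_tensor[of _ _ B] L_transform_first_slice_tensor[of _ _ C])
  then show "T = first_slice_tensor n (B * C)"
    if "T \<in> carrier_tensor n \<and> (\<forall>i<n. L_transform n T ! i =
      L_transform n (first_slice_tensor n B) ! i * L_transform n (first_slice_tensor n C) ! i)" for T
    using that by (intro L_transform_injective[of _ n]) simp_all
qed

lemma identity_tensor_eq:
  assumes n: "0 < n"
  shows "identity_tensor n = first_slice_tensor n (1\<^sub>m n)"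
  unfolding identity_tensor_def
proof (rule the_equality)
  show "first_slice_tensor n (1\<^sub>m n) \<in> carrier_tensor n \<and>
    (\<forall>i<n. L_transform n (first_slice_tensor n (1\<^sub>m n)) ! i = 1\<^sub>m n)"
    using n by (simp add: first_slice_tensor_carrier L_transform_first_slice_tensor)
  then show "T = first_slice_tensor n (1\<^sub>m n)"
    if "T \<in> carrier_tensor n \<and> (\<forall>i<n. L_transform n T ! i = 1\<^sub>m n)" for T
    using that n
    by (intro L_transform_injective[of _ n])
       (simp_all add: first_slice_tensor_carrier L_transform_first_slice_tensor)
qed

text \<open>
  The Hankel part involves only slices of positive number, which vanish here; the Toeplitz part has
  the first slice exactly on the block diagonal.
\<close>

lemma tensor_mat_first_slice_tensor:
  assumes B: "B \<in> carrier_mat n n"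
  shows "tensor_mat n (first_slice_tensor n B) = block_diag n B"
proof (rule eq_matI)
  fix r s assume "r < dim_row (block_diag n B)" "s < dim_col (block_diag n B)"
  then have r: "r < n * n" and s: "s < n * n" by (auto simp: block_diag_def)
  define p q where "p = r div n" and "q = s div n"
  have n: "0 < n" using r by (auto intro: Nat.gr0I)
  have pq: "p < n" "q < n" using r s by (auto simp: p_def q_def less_mult_imp_div_less)
  have "hankel_block n (first_slice_tensor n B) p q = 0\<^sub>m n n"
    using pq by (auto simp: hankel_block_def first_slice_tensor_nth)
  moreover have "first_slice_tensor n B ! nat \<bar>int p - int q\<bar> = (if p = q then B else 0\<^sub>m n n)"
    using pq by (subst first_slice_tensor_nth) auto
  ultimately have "mat_block n (first_slice_tensor n B) p q = (if p = q then B else 0\<^sub>m n n)"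
    using B by (simp add: mat_block_def)
  then show "tensor_mat n (first_slice_tensor n B) $$ (r, s) = block_diag n B $$ (r, s)"
    using r s n by (simp add: tensor_mat_def block_diag_def p_def q_def)
qed (auto simp: tensor_mat_def block_diag_def)

section \<open>Transition tensors\<close>

text \<open>
  Compare the column sums of the first two transformed slices.  Write \<open>w l k\<close> for the sum of
  column \<open>k\<close> of slice \<open>l\<close>.  Slice 0 gives \<open>w 0 k + (\<Sum>l>0. 2 * w l k) = 1\<close>, and slice 1 the same equation
  with the weights \<open>2\<close> replaced by \<open>2 * cos (l * pi / n) < 2\<close>.  All \<open>w l k\<close> are nonnegative, so
  subtracting the equations shows \<open>w l k = 0\<close> for \<open>l > 0\<close>, and nonnegative entries with sum zero vanish.
\<close>

lemma transition_tensor_first_slice: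
  assumes n: "0 < n" and P: "transition_tensor n P"
  obtains Q where "Q \<in> carrier_mat n n" "P = first_slice_tensor n Q"
    "\<And>i j. i < n \<Longrightarrow> j < n \<Longrightarrow> 0 \<le> Q $$ (i, j)"
    "\<And>k. k < n \<Longrightarrow> (\<Sum>j<n. Q $$ (j, k)) = 1"
proof -
  have PC: "P \<in> carrier_tensor n" using P by (simp add: transition_tensor_def)
  then have len: "length P = n" by (simp add: carrier_tensor_def)
  have nonneg: "0 \<le> (P ! l) $$ (i, j)" if "i < n" "j < n" "l < n" for i j l
    using P that by (simp add: transition_tensor_def)
  \<comment> \<open>column sums of the slices, and the weights with which slice \<open>i\<close> of the transform combines them\<close>
  define w where "w l k = (\<Sum>j<n. (P ! l) $$ (j, k))" for l k
  define m where "m i l = (if l = 0 then 1 else 2 * cos (real l * (real i * pi / real n)))" for i l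
  have w_nonneg: "0 \<le> w l k" if "l < n" "k < n" for l k
    using nonneg that by (auto simp: w_def intro!: sum_nonneg)
  have row: "(\<Sum>l<n. m i l * w l k) = 1" if i: "i < n" and k: "k < n" for i k
  proof -
    have "complex_of_real (\<Sum>l<n. m i l * w l k) =
        (\<Sum>j<n. \<Sum>l<n. complex_of_real (m i l * (P ! l) $$ (j, k)))"
      by (subst sum.swap) (simp add: w_def sum_distrib_left)
    also have "\<dots> = (\<Sum>j<n. (L_transform n (complex_tensor P) ! i) $$ (j, k))"
    proof (rule sum.cong[OF refl])
      fix j assume "j \<in> {..<n}"
      then show "(\<Sum>l<n. complex_of_real (m i l * (P ! l) $$ (j, k))) =
          (L_transform n (complex_tensor P) ! i) $$ (j, k)"
        using i k carrier_matD[OF carrier_tensor_nth[OF PC]]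
        by (auto simp: L_transform_nth complex_tensor_def len M_matrix_index m_def intro!: sum.cong)
    qed
    also have "\<dots> = 1" using P i k by (simp add: transition_tensor_def)
    finally show ?thesis by (simp only: of_real_eq_1_iff)
  qed
  have w_zero: "w l k = 0" if l: "0 < l" "l < n" and k: "k < n" for l k
  proof -
    have "(\<Sum>l<n. (m 0 l - m 1 l) * w l k) = 0"
      using row[of 0 k] row[of 1 k] l k by (simp add: left_diff_distrib sum_subtractf)
    moreover have cos_less: "m 1 l < m 0 l" if "0 < l" "l < n" for l
    proof -
      have "cos (real l * (pi / real n)) < cos 0"
        using that by (intro cos_monotone_0_pi) (auto simp: field_simps)
      then show ?thesis using that by (simp add: m_def)
    qed
    moreover have "m 1 l \<le> m 0 l" if "l < n" for l
      using cos_less[of l] that by (cases "l = 0") (auto simp: m_def)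
    ultimately have "(m 0 l - m 1 l) * w l k = 0"
      using l k w_nonneg by (subst (asm) sum_nonneg_eq_0_iff) auto
    then show ?thesis using cos_less[OF l] by simp
  qed
  have "P = first_slice_tensor n (P ! 0)"
  proof (rule nth_equalityI)
    fix l assume "l < length P"
    then have l: "l < n" by (simp add: len)
    have "P ! l = 0\<^sub>m n n" if "l \<noteq> 0"
    proof (rule eq_matI)
      fix i j assume "i < dim_row (0\<^sub>m n n)" "j < dim_col (0\<^sub>m n n)"
      then have ij: "i < n" "j < n" by auto
      have "(\<Sum>i<n. (P ! l) $$ (i, j)) = 0"
        using w_zero[of l j] l that ij by (simp add: w_def)
      then have "\<forall>i\<in>{..<n}. (P ! l) $$ (i, j) = 0"
        using nonneg l ij by (subst (asm) sum_nonneg_eq_0_iff) auto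
      then show "(P ! l) $$ (i, j) = 0\<^sub>m n n $$ (i, j)" using ij by simp
    qed (use carrier_tensor_nth[OF PC l] in auto)
    then show "P ! l = first_slice_tensor n (P ! 0) ! l"
      using l by (simp add: first_slice_tensor_nth)
  qed (use n len in \<open>simp add: length_first_slice_tensor\<close>)
  moreover have "(\<Sum>j<n. (P ! 0) $$ (j, k)) = 1" if k: "k < n" for k
  proof -
    have "(\<Sum>l<n. m 0 l * w l k) = (\<Sum>l<n. if l = 0 then w 0 k else 0)"
      using w_zero[OF _ _ k] by (intro sum.cong) (auto simp: m_def)
    then show ?thesis using row[OF n k] n by (simp add: w_def)
  qed
  ultimately show thesis
    using that[of "P ! 0"] carrier_tensor_nth[OF PC n] nonneg n by blast
qed

text \<open>
  Column-stochastic matrices are closed under products, so the powers of one of them are bounded.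
\<close>

lemma column_stochastic_power:
  fixes Q :: "real mat"
  assumes Q: "Q \<in> carrier_mat n n"
    and nonneg: "\<And>i j. i < n \<Longrightarrow> j < n \<Longrightarrow> 0 \<le> Q $$ (i, j)"
    and sums: "\<And>k. k < n \<Longrightarrow> (\<Sum>j<n. Q $$ (j, k)) = 1"
  shows "(\<forall>i<n. \<forall>j<n. 0 \<le> (Q ^\<^sub>m N) $$ (i, j)) \<and> (\<forall>k<n. (\<Sum>j<n. (Q ^\<^sub>m N) $$ (j, k)) = 1)"
proof (induction N)
  case 0
  then show ?case using Q by auto
next
  case (Suc N)
  have QN: "Q ^\<^sub>m N \<in> carrier_mat n n" using Q by (rule pow_carrier_mat)
  have entry: "(Q ^\<^sub>m Suc N) $$ (i, j) = (\<Sum>t<n. (Q ^\<^sub>m N) $$ (i, t) * Q $$ (t, j))"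
    if "i < n" "j < n" for i j
    using that Q QN by (auto simp: scalar_prod_def atLeast0LessThan)
  have "(\<Sum>j<n. (Q ^\<^sub>m Suc N) $$ (j, k)) = 1" if k: "k < n" for k
  proof -
    have "(\<Sum>j<n. (Q ^\<^sub>m Suc N) $$ (j, k)) = (\<Sum>t<n. \<Sum>j<n. (Q ^\<^sub>m N) $$ (j, t) * Q $$ (t, k))"
      using k by (subst sum.swap) (simp add: entry del: pow_mat.simps)
    also have "\<dots> = (\<Sum>t<n. Q $$ (t, k))"
      using Suc by (intro sum.cong) (auto simp flip: sum_distrib_right)
    finally show ?thesis using sums k by simp
  qed
  then show ?case
    using Suc nonneg by (auto simp: entry simp del: pow_mat.simps intro!: sum_nonneg mult_nonneg_nonneg)
qed

lemma column_stochastic_power_bounded: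
  fixes Q :: "real mat"
  assumes Q: "Q \<in> carrier_mat n n"
    and nonneg: "\<And>i j. i < n \<Longrightarrow> j < n \<Longrightarrow> 0 \<le> Q $$ (i, j)"
    and sums: "\<And>k. k < n \<Longrightarrow> (\<Sum>j<n. Q $$ (j, k)) = 1"
    and ij: "i < n" "j < n"
  shows "norm ((map_mat complex_of_real Q ^\<^sub>m N) $$ (i, j)) \<le> 1"
proof -
  have QN: "Q ^\<^sub>m N \<in> carrier_mat n n" using Q by (rule pow_carrier_mat)
  have st: "\<And>i. i < n \<Longrightarrow> 0 \<le> (Q ^\<^sub>m N) $$ (i, j)" "(\<Sum>i<n. (Q ^\<^sub>m N) $$ (i, j)) = 1"
    using column_stochastic_power[OF Q nonneg sums, of N] ij by auto
  have "(Q ^\<^sub>m N) $$ (i, j) \<le> (\<Sum>i<n. (Q ^\<^sub>m N) $$ (i, j))"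
    using st(1) ij by (intro member_le_sum) auto
  then show ?thesis
    using st ij carrier_matD[OF QN] by (simp flip: of_real_hom.mat_hom_pow[OF Q])
qed

theorem theorem6p1:
  fixes n :: nat and P :: "real tensor" and A :: "complex tensor"
  assumes "n \<ge> 1"
    and "transition_tensor n P"
    and "A = tensor_minus (identity_tensor n) (complex_tensor P)"
  shows "\<exists>X. is_group_inverse n A X"
proof -
  have n: "0 < n" using assms(1) by simp
  obtain Q where Q: "Q \<in> carrier_mat n n" and PQ: "P = first_slice_tensor n Q"
    and nonneg: "\<And>i j. i < n \<Longrightarrow> j < n \<Longrightarrow> 0 \<le> Q $$ (i, j)"
    and sums: "\<And>k. k < n \<Longrightarrow> (\<Sum>j<n. Q $$ (j, k)) = 1"
    using transition_tensor_first_slice[OF n assms(2)] by blast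
  define R where "R = map_mat complex_of_real Q"
  define B where "B = 1\<^sub>m n - R"
  have R: "R \<in> carrier_mat n n" using Q by (simp add: R_def)
  have B: "B \<in> carrier_mat n n" using R unfolding B_def by (rule minus_carrier_mat)
  have A: "A = first_slice_tensor n B"
    unfolding assms(3) identity_tensor_eq[OF n] PQ
    by (auto simp: tensor_minus_def complex_tensor_def first_slice_tensor_def B_def R_def
      zip_replicate intro!: eq_matI)
  obtain X where X: "X \<in> carrier_mat n n" "B * B * X = B" "X * B * X = X" "B * X = X * B"
    using power_bounded_imp_group_inverse[OF R _ B_def, of 1]
      column_stochastic_power_bounded[OF Q nonneg sums] unfolding R_def by blast
  have "(\<Sum>j = 0..<n. B $$ (j, k)) = 0" if k: "k < n" for k
  proof -
    have "(\<Sum>j = 0..<n. B $$ (j, k)) = (\<Sum>j<n. (if j = k then 1 else 0) - of_real (Q $$ (j, k)))"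
      using k Q by (auto simp: B_def R_def atLeast0LessThan intro!: sum.cong)
    also have "\<dots> = 1 - of_real (\<Sum>j<n. Q $$ (j, k))"
      using k by (simp add: sum_subtractf)
    finally show ?thesis using sums[OF k] by simp
  qed
  then have "det (block_diag n B) = 0"
    by (rule det_block_diag_eq_0[OF n B])
  moreover have "block_diag n B * block_diag n B * block_diag n X = block_diag n B"
    using B X by (simp add: block_diag_mult)
  ultimately have index: "tensor_index n A = 1"
    unfolding tensor_index_def A tensor_mat_first_slice_tensor[OF B]
    by (intro mat_index_eq_1[OF block_diag_carrier block_diag_carrier])
  have "is_drazin_inverse n A (first_slice_tensor n X)"
    using n B X by (simp add: is_drazin_inverse_def A index[unfolded A] identity_tensor_eq cprod_first_slice_tensor
      first_slice_tensor_carrier numeral_2_eq_2)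
  then show ?thesis
    using index by (auto simp: is_group_inverse_def)
qed

end
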